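(* Let $s$ be a complete solution of a job-shop scheduling instance, let $G$ be its directed disjunctive graph with node set $\mathcal{O}$, and let $H$ be the number of nodes on a path from $O_S$ to $O_T$ in $G$ containing the most nodes. Maintain for each node $V\in\mathcal{O}$ a message $(d_V,c_V)$ with initial values $d_V=0$ for all $V$, $c_V=1$ for all $V\neq O_S$, and $c_{O_S}=0$. In each round of message passing, update all nodes simultaneously, using the values from the previous round on the right-hand sides, by $$d_V=\max_{U\in\mathcal{N}(V)}\big(p_U+(1-c_U)\cdot d_U\big),\qquad c_V=\max_{U\in\mathcal{N}(V)}c_U .$$ Then after at most $H$ rounds of message passing (i.e. after $k$ rounds for some $k\le H$), $d_V=est_V$ for all $V\in\mathcal{O}$, and $d_{O_T}=C_{\max}(s)$.
   Context: Job-shop instance: there are finite sets of jobs $\mathcal{J}$ and machines $\mathcal{M}$; each job consists of $|\mathcal{M}|$ operations to be processed in a prescribed order, one on each machine; each operation $V$ has a processing time $p_V\in\mathbb{N}$. Disjunctive graph of a solution: $G=(\mathcal{O},\mathcal{C}\cup\mathcal{D})$, where $\mathcal{O}$ consists of all operations plus two dummy nodes $O_S$ (start) and $O_T$ (end) with processing time $0$. The set $\mathcal{C}$ consists of the arcs from $O_S$ to the first operation of each job, from each operation to the next operation of the same job, and from the last operation of each job to $O_T$. A solution $s$ fixes, for each machine, a processing order of the operations on it, and $\mathcal{D}$ consists of the arcs from each operation to the next one on the same machine; $s$ being a solution means that $G$ is acyclic. Each arc carries as weight the processing time of the operation it points from. The neighbourhood $\mathcal{N}(V)$ is the set of nodes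 $U$ with an arc from $U$ to $V$. A node with empty neighbourhood (only $O_S$) keeps its initial message in every round. The earliest starting time is given by $est_{O_S}=0$ and $est_V=\max_{U\in\mathcal{N}(V)}(p_U+est_U)$ for $V\neq O_S$ (recursively along a topological order of $G$); equivalently, it is the length of a longest weighted path from $O_S$ to $V$. The makespan $C_{\max}(s)$ is the length of a longest weighted path from $O_S$ to $O_T$ (a critical path) in $G$. *)

theory Defs
  imports Main
begin

text \<open>
  Job-shop instances. The operation of job \<open>j\<close> on machine \<open>m\<close> is identified with the pair
  \<open>(j, m)\<close>; \<open>route I j\<close> lists the machines in the order in which job \<open>j\<close> has to visit them.
\<close>

record ('j, 'm) job_shop =
  jobs :: "'j set"
  machines :: "'m set"
  route :: "'j \<Rightarrow> 'm list"
  proc_time :: "'j \<Rightarrow> 'm \<Rightarrow> nat"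

text \<open>
  Both sets are required to be nonempty: otherwise there are no arcs at all and the end node has
  an empty neighbourhood.
\<close>

definition job_shop_instance :: "('j, 'm) job_shop \<Rightarrow> bool" where
  "job_shop_instance I \<longleftrightarrow>
     finite (jobs I) \<and> jobs I \<noteq> {} \<and> finite (machines I) \<and> machines I \<noteq> {} \<and>
     (\<forall>j\<in>jobs I. distinct (route I j) \<and> set (route I j) = machines I)"

datatype ('j, 'm) node = Start | Oper 'j 'm | End

definition nodes :: "('j, 'm) job_shop \<Rightarrow> ('j, 'm) node set" where
  "nodes I = {Start, End} \<union> {Oper j m | j m. j \<in> jobs I \<and> m \<in> machines I}"

fun p :: "('j, 'm) job_shop \<Rightarrow> ('j, 'm) node \<Rightarrow> nat" where
  "p I Start = 0"
| "p I (Oper j m) = proc_time I j m"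
| "p I End = 0"

definition conjunctive_arcs :: "('j, 'm) job_shop \<Rightarrow> ('j, 'm) node rel" where
  "conjunctive_arcs I =
     {(Start, Oper j (hd (route I j))) | j. j \<in> jobs I} \<union>
     {(Oper j (route I j ! i), Oper j (route I j ! Suc i)) | j i.
        j \<in> jobs I \<and> Suc i < length (route I j)} \<union>
     {(Oper j (last (route I j)), End) | j. j \<in> jobs I}"

text \<open>
  A (candidate) solution \<open>s\<close> assigns to each machine the list of all jobs, in the order in which
  their operations are processed on that machine.
\<close>

definition disjunctive_arcs ::
    "('j, 'm) job_shop \<Rightarrow> ('m \<Rightarrow> 'j list) \<Rightarrow> ('j, 'm) node rel" where
  "disjunctive_arcs I s =
     {(Oper (s m ! i) m, Oper (s m ! Suc i) m) | m i. m \<in> machines I \<and> Suc i < length (s m)}"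

definition arcs :: "('j, 'm) job_shop \<Rightarrow> ('m \<Rightarrow> 'j list) \<Rightarrow> ('j, 'm) node rel" where
  "arcs I s = conjunctive_arcs I \<union> disjunctive_arcs I s"

definition complete_solution :: "('j, 'm) job_shop \<Rightarrow> ('m \<Rightarrow> 'j list) \<Rightarrow> bool" where
  "complete_solution I s \<longleftrightarrow>
     (\<forall>m\<in>machines I. distinct (s m) \<and> set (s m) = jobs I) \<and> acyclic (arcs I s)"

definition nbhd ::
    "('j, 'm) job_shop \<Rightarrow> ('m \<Rightarrow> 'j list) \<Rightarrow> ('j, 'm) node \<Rightarrow> ('j, 'm) node set" where
  "nbhd I s V = {U. (U, V) \<in> arcs I s}"

text \<open>
  The recursion for the earliest starting time is along the arc relation, which is well-founded
  for a solution; the defining equations are \<open>est_Start\<close> and \<open>est_rec\<close> below.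
\<close>

definition est :: "('j, 'm) job_shop \<Rightarrow> ('m \<Rightarrow> 'j list) \<Rightarrow> ('j, 'm) node \<Rightarrow> nat" where
  "est I s = wfrec (arcs I s)
     (\<lambda>f V. if V = Start then 0 else Max ((\<lambda>U. p I U + f U) ` nbhd I s V))"

definition is_path ::
    "('j, 'm) job_shop \<Rightarrow> ('m \<Rightarrow> 'j list) \<Rightarrow>
     ('j, 'm) node \<Rightarrow> ('j, 'm) node list \<Rightarrow> ('j, 'm) node \<Rightarrow> bool" where
  "is_path I s U xs V \<longleftrightarrow>
     xs \<noteq> [] \<and> hd xs = U \<and> last xs = V \<and> distinct xs \<and>
     successively (\<lambda>x y. (x, y) \<in> arcs I s) xs"

text \<open>
  An arc weighs the processing time of its tail, so the last node of a path does not count.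
\<close>

definition path_weight :: "('j, 'm) job_shop \<Rightarrow> ('j, 'm) node list \<Rightarrow> nat" where
  "path_weight I xs = sum_list (map (p I) (butlast xs))"

definition makespan :: "('j, 'm) job_shop \<Rightarrow> ('m \<Rightarrow> 'j list) \<Rightarrow> nat" where
  "makespan I s = Max {path_weight I xs | xs. is_path I s Start xs End}"

definition max_path_nodes :: "('j, 'm) job_shop \<Rightarrow> ('m \<Rightarrow> 'j list) \<Rightarrow> nat" where
  "max_path_nodes I s = Max {length xs | xs. is_path I s Start xs End}"

text \<open>
  A message is a pair \<open>(d, c)\<close>. Since \<open>c\<close> only takes the values 0 and 1 (\<open>msg_c_le_1\<close> below),
  the subtraction \<open>1 - c\<close> on natural numbers never truncates.
\<close>

fun init_msg :: "('j, 'm) node \<Rightarrow> nat \<times> nat" where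
  "init_msg V = (0, if V = Start then 0 else 1)"

definition message_round ::
    "('j, 'm) job_shop \<Rightarrow> ('m \<Rightarrow> 'j list) \<Rightarrow>
     (('j, 'm) node \<Rightarrow> nat \<times> nat) \<Rightarrow> ('j, 'm) node \<Rightarrow> nat \<times> nat" where
  "message_round I s \<mu> V =
     (if nbhd I s V = {} then \<mu> V
      else (Max ((\<lambda>U. p I U + (1 - snd (\<mu> U)) * fst (\<mu> U)) ` nbhd I s V),
            Max ((\<lambda>U. snd (\<mu> U)) ` nbhd I s V)))"

primrec msg ::
    "('j, 'm) job_shop \<Rightarrow> ('m \<Rightarrow> 'j list) \<Rightarrow> nat \<Rightarrow> ('j, 'm) node \<Rightarrow> nat \<times> nat" where
  "msg I s 0 = init_msg"
| "msg I s (Suc k) = message_round I s (msg I s k)"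

abbreviation msg_d ::
    "('j, 'm) job_shop \<Rightarrow> ('m \<Rightarrow> 'j list) \<Rightarrow> nat \<Rightarrow> ('j, 'm) node \<Rightarrow> nat" where
  "msg_d I s k V \<equiv> fst (msg I s k V)"


text \<open>
  All maxima above range over finite nonempty sets.
\<close>

lemma arcs_subset_nodes:
  assumes "job_shop_instance I" "complete_solution I s"
  shows "arcs I s \<subseteq> nodes I \<times> nodes I"
proof -
  have ne: "route I j \<noteq> []" "set (route I j) = machines I" if "j \<in> jobs I" for j
    using assms(1) that unfolding job_shop_instance_def by fastforce+
  have r: "route I j ! i \<in> machines I" if "j \<in> jobs I" "i < length (route I j)" for j i
    using ne[OF that(1)] nth_mem[OF that(2)] by simp
  have hl: "hd (route I j) \<in> machines I" "last (route I j) \<in> machines I" if "j \<in> jobs I" for j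
    using ne[OF that] hd_in_set last_in_set by metis+
  have m: "s m ! i \<in> jobs I" if "m \<in> machines I" "i < length (s m)" for m i
    using assms(2) nth_mem[OF that(2)] that(1) unfolding complete_solution_def by auto
  show ?thesis
    unfolding arcs_def conjunctive_arcs_def disjunctive_arcs_def nodes_def
    by (auto simp: hl r m)
qed

lemma finite_nodes:
  assumes "job_shop_instance I"
  shows "finite (nodes I)"
proof -
  have "{Oper j m | j m. j \<in> jobs I \<and> m \<in> machines I}
        = (\<lambda>(j, m). Oper j m) ` (jobs I \<times> machines I)" by auto
  then show ?thesis using assms unfolding nodes_def job_shop_instance_def by simp
qed

lemma finite_arcs:
  assumes "job_shop_instance I" "complete_solution I s"
  shows "finite (arcs I s)"
  using arcs_subset_nodes[OF assms] finite_nodes[OF assms(1)]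
  by (meson finite_SigmaI finite_subset)

lemma finite_nbhd:
  assumes "job_shop_instance I" "complete_solution I s"
  shows "finite (nbhd I s V)"
proof -
  have "nbhd I s V \<subseteq> fst ` arcs I s" unfolding nbhd_def by force
  then show ?thesis using finite_arcs[OF assms] finite_subset by blast
qed

lemma nbhd_empty_iff:
  assumes "job_shop_instance I" "V \<in> nodes I"
  shows "nbhd I s V = {} \<longleftrightarrow> V = Start"
proof
  assume "V = Start"
  then show "nbhd I s V = {}"
    unfolding nbhd_def arcs_def conjunctive_arcs_def disjunctive_arcs_def by auto
next
  assume e: "nbhd I s V = {}"
  show "V = Start"
  proof (cases V)
    case (Oper j m)
    then have jm: "j \<in> jobs I" "m \<in> set (route I j)"
      using assms unfolding nodes_def job_shop_instance_def by auto
    then obtain i where i: "i < length (route I j)" "m = route I j ! i"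
      by (metis in_set_conv_nth)
    have "\<exists>U. (U, V) \<in> conjunctive_arcs I"
    proof (cases i)
      case 0
      then have "m = hd (route I j)" using i by (metis hd_conv_nth length_greater_0_conv)
      then show ?thesis using jm Oper unfolding conjunctive_arcs_def by blast
    next
      case (Suc i')
      then show ?thesis using jm i Oper unfolding conjunctive_arcs_def by blast
    qed
    then show ?thesis using e unfolding nbhd_def arcs_def by blast
  next
    case End
    obtain j where "j \<in> jobs I" using assms unfolding job_shop_instance_def by blast
    then have "(Oper j (last (route I j)), V) \<in> conjunctive_arcs I"
      using End unfolding conjunctive_arcs_def by blast
    then show ?thesis using e unfolding nbhd_def arcs_def by blast
  qed
qed

lemma wf_arcs:
  assumes "job_shop_instance I" "complete_solution I s"
  shows "wf (arcs I s)"
  using finite_acyclic_wf[OF finite_arcs[OF assms]] assms(2)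
  unfolding complete_solution_def by blast

lemma est_unfold:
  assumes "job_shop_instance I" "complete_solution I s"
  shows "est I s V = (if V = Start then 0 else Max ((\<lambda>U. p I U + est I s U) ` nbhd I s V))"
proof -
  have "(\<lambda>U. p I U + cut (est I s) (arcs I s) V U) ` nbhd I s V
        = (\<lambda>U. p I U + est I s U) ` nbhd I s V"
    by (rule image_cong) (auto simp: nbhd_def cut_apply)
  then show ?thesis
    using wfrec[OF wf_arcs[OF assms], of
        "\<lambda>f V. if V = Start then 0 else Max ((\<lambda>U. p I U + f U) ` nbhd I s V)" V]
    unfolding est_def by simp
qed

lemma est_Start:
  assumes "job_shop_instance I" "complete_solution I s"
  shows "est I s Start = 0"
  using est_unfold[OF assms, of Start] by simp

lemma est_rec:
  assumes "job_shop_instance I" "complete_solution I s" "V \<noteq> Start"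
  shows "est I s V = Max ((\<lambda>U. p I U + est I s U) ` nbhd I s V)"
  using est_unfold[OF assms(1,2), of V] assms(3) by simp

lemma finite_paths:
  assumes "job_shop_instance I" "complete_solution I s"
  shows "finite {xs. is_path I s Start xs End}"
proof -
  have "set xs \<subseteq> nodes I" if "is_path I s Start xs End" for xs
  proof -
    have "successively (\<lambda>x y. (x, y) \<in> arcs I s) xs" "hd xs = Start"
      using that unfolding is_path_def by auto
    then have "hd xs \<in> nodes I" "successively (\<lambda>x y. (x, y) \<in> arcs I s) xs"
      by (auto simp: nodes_def)
    then show ?thesis
      using arcs_subset_nodes[OF assms]
      by (induction "\<lambda>x y. (x, y) \<in> arcs I s" xs rule: successively.induct) auto
  qed
  then have "{xs. is_path I s Start xs End} \<subseteq> {xs. set xs \<subseteq> nodes I \<and> length xs \<le> card (nodes I)}"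
    using finite_nodes[OF assms(1)] unfolding is_path_def
    by (auto simp: card_mono simp flip: distinct_card)
  then show ?thesis
    using finite_lists_length_le[OF finite_nodes[OF assms(1)]] finite_subset by blast
qed

lemma path_exists:
  assumes "job_shop_instance I"
  shows "\<exists>xs. is_path I s Start xs End"
proof -
  obtain j where j: "j \<in> jobs I" using assms unfolding job_shop_instance_def by blast
  let ?r = "route I j"
  let ?xs = "Start # map (Oper j) ?r @ [End]"
  have r: "?r \<noteq> []" "distinct ?r"
    using assms j unfolding job_shop_instance_def by fastforce+
  have "successively (\<lambda>x y. (x, y) \<in> arcs I s) (map (Oper j) ?r)"
    using j unfolding successively_conv_nth arcs_def conjunctive_arcs_def by auto
  moreover have "(Start, Oper j (hd ?r)) \<in> arcs I s" "(Oper j (last ?r), End) \<in> arcs I s"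
    using j unfolding arcs_def conjunctive_arcs_def by blast+
  ultimately have "is_path I s Start ?xs End"
    using r unfolding is_path_def
    by (auto simp: successively_Cons successively_append_iff hd_map last_map distinct_map inj_on_def)
  then show ?thesis by blast
qed

lemma msg_c_le_1:
  assumes "job_shop_instance I" "complete_solution I s"
  shows "snd (msg I s k V) \<le> 1"
proof (induction k arbitrary: V)
  case (Suc k)
  then show ?case
    using finite_nbhd[OF assms, of V] by (auto simp: message_round_def)
qed auto

end

theory Submission
  imports Defs
begin

text \<open>
  A node has \<open>c = 0\<close> only after all its predecessors had \<open>c = 0\<close> one round earlier, so inductively
  \<open>c = 0\<close> certifies \<open>d = est\<close>. Conversely, \<open>c \<noteq> 0\<close> after \<open>k\<close> rounds can be traced back along
  \<open>k\<close> arcs. As every node lies on a walk from the start to the end node, and walks in an acyclic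
  graph are paths, this gives a path with more than \<open>k\<close> nodes, which is impossible for \<open>k = H\<close>.
\<close>

text \<open>A repeated entry would close a cycle. Passing to the transitive closure makes the
  relation between neighbours in the list hold between any two positions.\<close>

lemma distinct_if_successively_acyclic:
  assumes "acyclic R" "successively (\<lambda>x y. (x, y) \<in> R) xs"
  shows "distinct xs"
proof -
  have "successively (\<lambda>x y. (x, y) \<in> R\<^sup>+) xs"
    using assms(2) by (rule successively_mono) auto
  then have "sorted_wrt (\<lambda>x y. (x, y) \<in> R\<^sup>+) xs"
    by (subst (asm) successively_conv_sorted_wrt) (auto intro!: transpI)
  then show ?thesis
    using assms(1) by (induction xs) (auto simp: acyclic_def)
qed

text \<open>The nodes visited by a walk are distinct by acyclicity. The count \<open>Suc n\<close>
  (nodes, not arcs) makes the later bound on walk lengths strict.\<close>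

lemma relpow_imp_path:
  assumes "complete_solution I s" "(U, V) \<in> arcs I s ^^ n"
  shows "\<exists>xs. is_path I s U xs V \<and> length xs = Suc n"
proof -
  obtain f where f: "f 0 = U" "f n = V" "\<And>i. i < n \<Longrightarrow> (f i, f (Suc i)) \<in> arcs I s"
    using assms(2) unfolding relpow_fun_conv by blast
  let ?xs = "map f [0..<Suc n]"
  have s: "successively (\<lambda>x y. (x, y) \<in> arcs I s) ?xs"
    unfolding successively_conv_nth using f(3) by (auto simp del: upt_Suc)
  have "distinct ?xs"
    using distinct_if_successively_acyclic[OF _ s] assms(1)
    unfolding complete_solution_def by blast
  moreover have "hd ?xs = U" "last ?xs = V"
    using f(1,2) by (simp_all add: hd_map last_map del: upt_Suc)
  ultimately have "is_path I s U ?xs V"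
    using s unfolding is_path_def by simp
  then show ?thesis by (intro exI[of _ ?xs]) simp
qed

lemma nbhd_subset_nodes:
  assumes "job_shop_instance I" "complete_solution I s"
  shows "nbhd I s V \<subseteq> nodes I"
  using arcs_subset_nodes[OF assms] unfolding nbhd_def by blast

lemma est_arc:
  assumes "job_shop_instance I" "complete_solution I s" "(U, V) \<in> arcs I s"
  shows "p I U + est I s U \<le> est I s V"
proof -
  have "V \<in> nodes I" "U \<in> nbhd I s V"
    using arcs_subset_nodes[OF assms(1,2)] assms(3) unfolding nbhd_def by auto
  moreover from this have "V \<noteq> Start" using nbhd_empty_iff[OF assms(1)] by blast
  ultimately show ?thesis
    using finite_nbhd[OF assms(1,2)] by (simp add: est_rec[OF assms(1,2)])
qed

text \<open>Telescopes \<open>est_arc\<close> along the list. From \<open>Start\<close>, where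
  \<open>est\<close> is 0, this bounds every path weight by \<open>est\<close> of the last
  node.\<close>

lemma est_plus_path_weight_le:
  assumes "job_shop_instance I" "complete_solution I s"
  assumes "successively (\<lambda>x y. (x, y) \<in> arcs I s) xs" "xs \<noteq> []"
  shows "est I s (hd xs) + path_weight I xs \<le> est I s (last xs)"
  using assms(3,4)
proof (induction xs rule: induct_list012)
  case (3 x y zs)
  then show ?case
    using est_arc[OF assms(1,2), of x y] by (auto simp: path_weight_def)
qed (auto simp: path_weight_def)

text \<open>The bound is attained: stepping back from \<open>V\<close> to a predecessor that
  realises the maximum reaches \<open>Start\<close> by well-foundedness.\<close>

lemma ex_path_weight_eq_est:
  assumes "job_shop_instance I" "complete_solution I s" "V \<in> nodes I"
  shows "\<exists>xs. is_path I s Start xs V \<and> path_weight I xs = est I s V"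
  using wf_arcs[OF assms(1,2)] assms(3)
proof (induction V rule: wf_induct_rule)
  case (less V)
  show ?case
  proof (cases "V = Start")
    case True
    then have "is_path I s Start [Start] V \<and> path_weight I [Start] = est I s V"
      using est_Start[OF assms(1,2)] by (simp add: is_path_def path_weight_def)
    then show ?thesis by blast
  next
    case False
    then have "nbhd I s V \<noteq> {}" using nbhd_empty_iff[OF assms(1) less.prems] by blast
    then have "est I s V \<in> (\<lambda>U. p I U + est I s U) ` nbhd I s V"
      unfolding est_rec[OF assms(1,2) False]
      using finite_nbhd[OF assms(1,2)] by (intro Max_in) auto
    then obtain U where U: "U \<in> nbhd I s V" "est I s V = p I U + est I s U" by blast
    then have a: "(U, V) \<in> arcs I s" unfolding nbhd_def by simp
    then obtain xs where xs: "is_path I s Start xs U" "path_weight I xs = est I s U"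
      using less.IH U(1) nbhd_subset_nodes[OF assms(1,2)] by blast
    have s: "successively (\<lambda>x y. (x, y) \<in> arcs I s) (xs @ [V])"
      using xs(1) a unfolding is_path_def by (simp add: successively_append_iff)
    then have "distinct (xs @ [V])"
      using distinct_if_successively_acyclic assms(2) unfolding complete_solution_def by blast
    then have "is_path I s Start (xs @ [V]) V"
      using s xs(1) unfolding is_path_def by simp
    \<comment> \<open>The last node of a path carries no weight, so appending \<open>V\<close> adds
      the weight of \<open>U\<close>, not of \<open>V\<close>.\<close>
    moreover have "path_weight I xs + p I U = path_weight I (xs @ [V])"
    proof -
      have "xs = butlast xs @ [U]" using xs(1) unfolding is_path_def by (metis append_butlast_last_id)
      then have "sum_list (map (p I) xs) = sum_list (map (p I) (butlast xs @ [U]))" by simp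
      then show ?thesis by (simp add: path_weight_def)
    qed
    ultimately show ?thesis using U(2) xs(2) by (intro exI[of _ "xs @ [V]"]) simp
  qed
qed

lemma makespan_eq_est_End:
  assumes "job_shop_instance I" "complete_solution I s"
  shows "makespan I s = est I s End"
  unfolding makespan_def
proof (rule Max_eqI)
  have "{path_weight I xs |xs. is_path I s Start xs End}
        = path_weight I ` {xs. is_path I s Start xs End}" by blast
  then show "finite {path_weight I xs |xs. is_path I s Start xs End}"
    using finite_paths[OF assms] by simp
next
  fix w assume "w \<in> {path_weight I xs |xs. is_path I s Start xs End}"
  then show "w \<le> est I s End"
    using est_plus_path_weight_le[OF assms] est_Start[OF assms] unfolding is_path_def by fastforce
next
  show "est I s End \<in> {path_weight I xs |xs. is_path I s Start xs End}"
    using ex_path_weight_eq_est[OF assms, of End] by (auto simp: nodes_def eq_commute)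
qed

text \<open>Every node other than \<open>Start\<close> has a predecessor, and going backwards must
  stop.\<close>

lemma reachable_from_Start:
  assumes "job_shop_instance I" "complete_solution I s" "V \<in> nodes I"
  shows "(Start, V) \<in> (arcs I s)\<^sup>*"
  using wf_arcs[OF assms(1,2)] assms(3)
proof (induction V rule: wf_induct_rule)
  case (less V)
  show ?case
  proof (cases "V = Start")
    case False
    then obtain U where "U \<in> nbhd I s V" using nbhd_empty_iff[OF assms(1) less.prems] by blast
    then have "(U, V) \<in> arcs I s" "U \<in> nodes I"
      using nbhd_subset_nodes[OF assms(1,2)] unfolding nbhd_def by auto
    then show ?thesis using less.IH by (meson rtrancl.rtrancl_into_rtrancl)
  qed simp
qed

text \<open>From an operation, follow the rest of its job to \<open>End\<close>.\<close>

lemma End_reachable: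
  assumes "job_shop_instance I" "complete_solution I s" "V \<in> nodes I"
  shows "(V, End) \<in> (arcs I s)\<^sup>*"
proof -
  have op: "(Oper j m, End) \<in> (arcs I s)\<^sup>*" if j: "j \<in> jobs I" "m \<in> machines I" for j m
  proof -
    let ?r = "route I j"
    \<comment> \<open>Induction runs downwards from the last position of the route, whose operation
      has an arc to \<open>End\<close>.\<close>
    have "(Oper j (?r ! i), End) \<in> (arcs I s)\<^sup>*" if "i \<le> length ?r - 1" "?r \<noteq> []" for i
      using that(1)
    proof (induction rule: inc_induct)
      case base
      have "(Oper j (last ?r), End) \<in> arcs I s"
        using j unfolding arcs_def conjunctive_arcs_def by blast
      then show ?case using that(2) by (simp add: last_conv_nth)
    next
      case (step i)
      then have "(Oper j (?r ! i), Oper j (?r ! Suc i)) \<in> arcs I s"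
        using j unfolding arcs_def conjunctive_arcs_def by auto
      then show ?case using step.IH by (rule converse_rtrancl_into_rtrancl)
    qed
    moreover have "m \<in> set ?r" using assms(1) j unfolding job_shop_instance_def by blast
    then obtain i where "i < length ?r" "?r ! i = m" by (auto simp: in_set_conv_nth)
    moreover from this have "i \<le> length ?r - 1" "?r \<noteq> []" by auto
    ultimately show ?thesis by blast
  qed
  have End: "End \<in> nodes I" unfolding nodes_def by simp
  \<comment> \<open>For \<open>Start\<close>, the claim is the forward reachability of
    \<open>End\<close>.\<close>
  show ?thesis
    using assms(3) op reachable_from_Start[OF assms(1,2) End] unfolding nodes_def by blast
qed

text \<open>A maximum of naturals is 0 only if all its terms are. So every factor
  \<open>1 - c\<close> in the last round was 1, and that round evaluated the recursion for
  \<open>est\<close> on values already correct.\<close>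

lemma msg_d_eq_est_if_c_zero:
  assumes "job_shop_instance I" "complete_solution I s" "V \<in> nodes I" "snd (msg I s k V) = 0"
  shows "msg_d I s k V = est I s V"
  using assms(3,4)
proof (induction k arbitrary: V)
  \<comment> \<open>Initially only \<open>Start\<close> has \<open>c = 0\<close>, and its
    \<open>d = 0\<close> is already correct.\<close>
  case 0
  then show ?case using est_Start[OF assms(1,2)] by (simp split: if_splits)
next
  case (Suc k)
  show ?case
  proof (cases "V = Start")
    case True
    then have "msg I s (Suc k) V = msg I s k V"
      using nbhd_empty_iff[OF assms(1) Suc.prems(1)] by (simp add: message_round_def)
    then show ?thesis using Suc by simp
  next
    case False
    then have ne: "nbhd I s V \<noteq> {}" using nbhd_empty_iff[OF assms(1) Suc.prems(1)] by blast
    have c: "snd (msg I s k U) = 0" if "U \<in> nbhd I s V" for U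
    proof -
      have "snd (msg I s k U) \<le> Max ((\<lambda>U. snd (msg I s k U)) ` nbhd I s V)"
        using finite_nbhd[OF assms(1,2)] that by (intro Max_ge) auto
      then show ?thesis using Suc.prems(2) ne by (simp add: message_round_def)
    qed
    have "(\<lambda>U. p I U + (1 - snd (msg I s k U)) * msg_d I s k U) ` nbhd I s V
        = (\<lambda>U. p I U + est I s U) ` nbhd I s V"
      using c Suc.IH nbhd_subset_nodes[OF assms(1,2)] by (intro image_cong) auto
    then show ?thesis
      using ne est_rec[OF assms(1,2) False] by (simp add: message_round_def)
  qed
qed

text \<open>A nonzero maximum is attained at a predecessor whose \<open>c\<close> was nonzero one
  round earlier; each round traced back contributes one arc.\<close>

lemma c_nonzero_imp_walk:
  assumes "job_shop_instance I" "complete_solution I s" "V \<in> nodes I" "snd (msg I s k V) \<noteq> 0"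
  shows "\<exists>U \<in> nodes I. (U, V) \<in> arcs I s ^^ k"
  using assms(3,4)
proof (induction k arbitrary: V)
  case (Suc k)
  \<comment> \<open>\<open>Start\<close> keeps its initial message, so tracing back never gets stuck
    there.\<close>
  have Start: "snd (msg I s n Start) = 0" for n
    using nbhd_empty_iff[OF assms(1), of Start s]
    by (induction n) (simp_all add: message_round_def nodes_def)
  then have "V \<noteq> Start" using Suc.prems(2) by metis
  then have ne: "nbhd I s V \<noteq> {}" using nbhd_empty_iff[OF assms(1) Suc.prems(1)] by blast
  then have "snd (msg I s (Suc k) V) \<in> (\<lambda>U. snd (msg I s k U)) ` nbhd I s V"
    using finite_nbhd[OF assms(1,2), of V] Max_in[of "(\<lambda>U. snd (msg I s k U)) ` nbhd I s V"]
    by (simp add: message_round_def)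
  then obtain W where "W \<in> nbhd I s V" "snd (msg I s k W) \<noteq> 0" using Suc.prems(2) by auto
  then show ?case
    using Suc.IH nbhd_subset_nodes[OF assms(1,2)] unfolding nbhd_def by fastforce
qed auto

text \<open>Extending the walk back to \<open>Start\<close> and on to \<open>End\<close> gives a
  path with at least \<open>k + 1\<close> nodes.\<close>

lemma walk_length_less_max_path_nodes:
  assumes "job_shop_instance I" "complete_solution I s"
  assumes "U \<in> nodes I" "V \<in> nodes I" "(U, V) \<in> arcs I s ^^ k"
  shows "k < max_path_nodes I s"
proof -
  obtain a b where "(Start, U) \<in> arcs I s ^^ a" "(V, End) \<in> arcs I s ^^ b"
    using reachable_from_Start[OF assms(1,2,3)] End_reachable[OF assms(1,2,4)]
    by (meson rtrancl_imp_relpow)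
  then have "(Start, End) \<in> arcs I s ^^ (a + k + b)"
    using assms(5) by (auto simp: relpow_add)
  then obtain xs where xs: "is_path I s Start xs End" "length xs = Suc (a + k + b)"
    using relpow_imp_path[OF assms(2)] by blast
  have "{length xs |xs. is_path I s Start xs End} = length ` {xs. is_path I s Start xs End}"
    by blast
  then have "length xs \<le> max_path_nodes I s"
    unfolding max_path_nodes_def using finite_paths[OF assms(1,2)] xs(1) by (intro Max_ge) auto
  then show ?thesis using xs(2) by simp
qed

theorem theorem4p2:
  fixes I :: "('j, 'm) job_shop" and s :: "'m \<Rightarrow> 'j list"
  assumes "job_shop_instance I" and "complete_solution I s"
  shows "\<exists>k \<le> max_path_nodes I s.
           (\<forall>V \<in> nodes I. msg_d I s k V = est I s V) \<and>
           msg_d I s k End = makespan I s"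
proof -
  let ?H = "max_path_nodes I s"
  \<comment> \<open>The witness is \<open>k = H\<close> itself: a nonzero \<open>c\<close> would
    yield a walk with \<open>H\<close> arcs, against the strict bound.\<close>
  have "snd (msg I s ?H V) = 0" if "V \<in> nodes I" for V
    using c_nonzero_imp_walk[OF assms that] walk_length_less_max_path_nodes[OF assms _ that]
    by blast
  then have d: "\<forall>V \<in> nodes I. msg_d I s ?H V = est I s V"
    using msg_d_eq_est_if_c_zero[OF assms] by blast
  moreover have "End \<in> nodes I" unfolding nodes_def by simp
  ultimately show ?thesis using makespan_eq_est_End[OF assms] by (intro exI[of _ ?H]) simp
qed

end
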